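(* Let $R$ be a ring and let $S$ be a multiplicatively closed subset of $R$ consisting of central regular elements. Then $R$ is $P$-symmetric if and only if $S^{-1}R$ is $P$-symmetric.
   Context: Rings are associative with identity (not necessarily commutative). A regular element is one that is neither a left nor a right zero divisor. $S^{-1}R=\{u^{-1}a\mid u\in S,\ a\in R\}$ is the localization of $R$ at $S$. $P(R)$ denotes the prime radical of a ring $R$ (the intersection of all prime two-sided ideals of $R$). A ring $R$ is $P$-symmetric if for any $a,b,c\in R$, $abc=0$ implies $bac\in P(R)$. *)

theory Defs
  imports "HOL-Algebra.Ideal_Product"
begin

(* The library's primeideal extends cring; this is the notion for arbitrary rings. *)
definition nc_primeideal :: "'a set \<Rightarrow> ('a, 'm) ring_scheme \<Rightarrow> bool" where
  "nc_primeideal P R \<longleftrightarrow>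
     ideal P R \<and> P \<noteq> carrier R \<and>
     (\<forall>I J. ideal I R \<longrightarrow> ideal J R \<longrightarrow> ideal_prod R I J \<subseteq> P \<longrightarrow> I \<subseteq> P \<or> J \<subseteq> P)"

(* The empty intersection, which occurs exactly for the zero ring, is the whole ring. *)
definition prime_radical :: "('a, 'm) ring_scheme \<Rightarrow> 'a set" where
  "prime_radical R = {x \<in> carrier R. \<forall>P. nc_primeideal P R \<longrightarrow> x \<in> P}"

definition P_symmetric :: "('a, 'm) ring_scheme \<Rightarrow> bool" where
  "P_symmetric R \<longleftrightarrow>
     (\<forall>a \<in> carrier R. \<forall>b \<in> carrier R. \<forall>c \<in> carrier R.
        a \<otimes>\<^bsub>R\<^esub> b \<otimes>\<^bsub>R\<^esub> c = \<zero>\<^bsub>R\<^esub> \<longrightarrow> b \<otimes>\<^bsub>R\<^esub> a \<otimes>\<^bsub>R\<^esub> c \<in> prime_radical R)"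

definition left_zero_divisor :: "('a, 'm) ring_scheme \<Rightarrow> 'a \<Rightarrow> bool" where
  "left_zero_divisor R a \<longleftrightarrow> (\<exists>b \<in> carrier R. b \<noteq> \<zero>\<^bsub>R\<^esub> \<and> a \<otimes>\<^bsub>R\<^esub> b = \<zero>\<^bsub>R\<^esub>)"

definition right_zero_divisor :: "('a, 'm) ring_scheme \<Rightarrow> 'a \<Rightarrow> bool" where
  "right_zero_divisor R a \<longleftrightarrow> (\<exists>b \<in> carrier R. b \<noteq> \<zero>\<^bsub>R\<^esub> \<and> b \<otimes>\<^bsub>R\<^esub> a = \<zero>\<^bsub>R\<^esub>)"

definition regular_element :: "('a, 'm) ring_scheme \<Rightarrow> 'a \<Rightarrow> bool" where
  "regular_element R a \<longleftrightarrow>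
     a \<in> carrier R \<and> \<not> left_zero_divisor R a \<and> \<not> right_zero_divisor R a"

definition central_element :: "('a, 'm) ring_scheme \<Rightarrow> 'a \<Rightarrow> bool" where
  "central_element R a \<longleftrightarrow> a \<in> carrier R \<and> (\<forall>b \<in> carrier R. a \<otimes>\<^bsub>R\<^esub> b = b \<otimes>\<^bsub>R\<^esub> a)"

(* Localization at a set S of central regular elements.  The pair (u, a) represents the
   fraction u^{-1} a; since the elements of S are regular, u^{-1} a = v^{-1} b just means
   v a = u b. *)
definition frac_rel :: "('a, 'm) ring_scheme \<Rightarrow> 'a set \<Rightarrow> (('a \<times> 'a) \<times> ('a \<times> 'a)) set" where
  "frac_rel R S = {((u, a), (v, b)).
     u \<in> S \<and> v \<in> S \<and> a \<in> carrier R \<and> b \<in> carrier R \<and> v \<otimes>\<^bsub>R\<^esub> a = u \<otimes>\<^bsub>R\<^esub> b}"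

definition loc_frac :: "('a, 'm) ring_scheme \<Rightarrow> 'a set \<Rightarrow> 'a \<Rightarrow> 'a \<Rightarrow> ('a \<times> 'a) set" where
  "loc_frac R S u a = frac_rel R S `` {(u, a)}"

(* The unions below are over classes and only serve to pick representatives: every term of such
   a union is the same class, see the lemmas loc_mult, loc_add, loc_zero and loc_one.
   The definition does not need the one of R to lie in S: the one and the zero of the
   localization are u^{-1} u and u^{-1} 0 for an arbitrary u in S. *)
definition localization :: "('a, 'm) ring_scheme \<Rightarrow> 'a set \<Rightarrow> ('a \<times> 'a) set ring" where
  "localization R S =
     \<lparr> carrier = (S \<times> carrier R) // frac_rel R S,
       mult = (\<lambda>X Y. \<Union>(u, a) \<in> X. \<Union>(v, b) \<in> Y. loc_frac R S (u \<otimes>\<^bsub>R\<^esub> v) (a \<otimes>\<^bsub>R\<^esub> b)),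
       one = (\<Union>u \<in> S. loc_frac R S u u),
       zero = (\<Union>u \<in> S. loc_frac R S u \<zero>\<^bsub>R\<^esub>),
       add = (\<lambda>X Y. \<Union>(u, a) \<in> X. \<Union>(v, b) \<in> Y.
                loc_frac R S (u \<otimes>\<^bsub>R\<^esub> v) (v \<otimes>\<^bsub>R\<^esub> a \<oplus>\<^bsub>R\<^esub> u \<otimes>\<^bsub>R\<^esub> b)) \<rparr>"

locale central_regular_mult_set = ring R for R (structure) and S +
  assumes S_nonempty: "S \<noteq> {}"
    and S_mult: "\<lbrakk>u \<in> S; v \<in> S\<rbrakk> \<Longrightarrow> u \<otimes> v \<in> S"
    and S_central: "u \<in> S \<Longrightarrow> central_element R u"
    and S_regular: "u \<in> S \<Longrightarrow> regular_element R u"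
begin

lemma S_carrier [simp]: "u \<in> S \<Longrightarrow> u \<in> carrier R"
  using S_central by (auto simp: central_element_def)

lemma S_comm: "\<lbrakk>u \<in> S; x \<in> carrier R\<rbrakk> \<Longrightarrow> x \<otimes> u = u \<otimes> x"
  using S_central unfolding central_element_def by metis

lemma S_lcomm: "\<lbrakk>u \<in> S; x \<in> carrier R; y \<in> carrier R\<rbrakk> \<Longrightarrow> x \<otimes> (u \<otimes> y) = u \<otimes> (x \<otimes> y)"
  by (metis S_carrier S_comm m_assoc)

lemma S_cancel:
  assumes "u \<in> S" "x \<in> carrier R" "y \<in> carrier R" "u \<otimes> x = u \<otimes> y"
  shows "x = y"
proof -
  have "u \<otimes> (x \<ominus> y) = \<zero>"
    using assms by (simp add: minus_eq r_distr r_minus r_neg)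
  then have "x \<ominus> y = \<zero>"
    using S_regular[OF assms(1)] assms by (auto simp: regular_element_def left_zero_divisor_def)
  then show ?thesis
    using assms by (metis S_carrier add.inv_solve_right a_minus_def add.m_closed l_zero zero_closed)
qed

lemma equiv_frac_rel: "equiv (S \<times> carrier R) (frac_rel R S)"
proof (rule equivI)
  show "frac_rel R S \<subseteq> (S \<times> carrier R) \<times> (S \<times> carrier R)"
    by (auto simp: frac_rel_def)
  show "refl_on (S \<times> carrier R) (frac_rel R S)"
    by (auto simp: frac_rel_def refl_on_def)
  show "sym (frac_rel R S)"
    by (auto simp: frac_rel_def sym_def)
  show "trans (frac_rel R S)"
  proof (rule transI, clarsimp simp: frac_rel_def)
    fix u a v b w c
    assume c: "u \<in> S" "v \<in> S" "w \<in> S" "a \<in> carrier R" "b \<in> carrier R" "c \<in> carrier R"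
      and 1: "v \<otimes> a = u \<otimes> b" and 2: "w \<otimes> b = v \<otimes> c"
    have "v \<otimes> (w \<otimes> a) = w \<otimes> (u \<otimes> b)"
      using c 1 S_lcomm[of w v a] by simp
    also have "\<dots> = v \<otimes> (u \<otimes> c)"
      using c 2 S_lcomm[of w u b] S_lcomm[of v u c] by simp
    finally show "w \<otimes> a = u \<otimes> c"
      using c S_cancel[of v] by simp
  qed
qed

lemma frac_eq_iff:
  "\<lbrakk>u \<in> S; v \<in> S; a \<in> carrier R; b \<in> carrier R\<rbrakk> \<Longrightarrow>
    loc_frac R S u a = loc_frac R S v b \<longleftrightarrow> v \<otimes> a = u \<otimes> b"
  unfolding loc_frac_def using eq_equiv_class_iff[OF equiv_frac_rel, of "(u,a)" "(v,b)"]
  by (simp add: frac_rel_def)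

lemma frac_closed [simp]:
  "\<lbrakk>u \<in> S; a \<in> carrier R\<rbrakk> \<Longrightarrow> loc_frac R S u a \<in> carrier (localization R S)"
  by (simp add: localization_def loc_frac_def quotientI)

lemma localization_cases:
  assumes "X \<in> carrier (localization R S)"
  obtains u a where "u \<in> S" "a \<in> carrier R" "X = loc_frac R S u a"
  using assms by (auto simp: localization_def loc_frac_def elim!: quotientE)

lemma mult_respects:
  "(\<lambda>p q. (\<lambda>(u, a). (\<lambda>(v, b). loc_frac R S (u \<otimes> v) (a \<otimes> b)) q) p) respects2 frac_rel R S"
proof (rule congruent2I', clarsimp simp: frac_rel_def)
  fix u a u' a' v b v' b'
  assume c: "u \<in> S" "u' \<in> S" "v \<in> S" "v' \<in> S"
    "a \<in> carrier R" "a' \<in> carrier R" "b \<in> carrier R" "b' \<in> carrier R"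
    and 1: "u' \<otimes> a = u \<otimes> a'" and 2: "v' \<otimes> b = v \<otimes> b'"
  have "(u' \<otimes> v') \<otimes> (a \<otimes> b) = (u' \<otimes> a) \<otimes> (v' \<otimes> b)"
    using c S_lcomm[of v' a b] by (simp add: m_assoc)
  also have "\<dots> = (u \<otimes> a') \<otimes> (v \<otimes> b')"
    by (simp only: 1 2)
  also have "\<dots> = (u \<otimes> v) \<otimes> (a' \<otimes> b')"
    using c S_lcomm[of v a' b'] by (simp add: m_assoc)
  finally show "loc_frac R S (u \<otimes> v) (a \<otimes> b) = loc_frac R S (u' \<otimes> v') (a' \<otimes> b')"
    using c by (simp add: frac_eq_iff S_mult)
qed

lemma add_respects:
  "(\<lambda>p q. (\<lambda>(u, a). (\<lambda>(v, b). loc_frac R S (u \<otimes> v) (v \<otimes> a \<oplus> u \<otimes> b)) q) p)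
     respects2 frac_rel R S"
proof (rule congruent2I', clarsimp simp: frac_rel_def)
  fix u a u' a' v b v' b'
  assume c: "u \<in> S" "u' \<in> S" "v \<in> S" "v' \<in> S"
    "a \<in> carrier R" "a' \<in> carrier R" "b \<in> carrier R" "b' \<in> carrier R"
    and 1: "u' \<otimes> a = u \<otimes> a'" and 2: "v' \<otimes> b = v \<otimes> b'"
  have "(u' \<otimes> v') \<otimes> (v \<otimes> a) = v \<otimes> (v' \<otimes> (u' \<otimes> a))"
    using c by (metis S_carrier S_lcomm m_assoc m_closed)
  also have "\<dots> = (u \<otimes> v) \<otimes> (v' \<otimes> a')"
    using c 1 by (metis S_carrier S_lcomm m_assoc m_closed)
  finally have A: "(u' \<otimes> v') \<otimes> (v \<otimes> a) = (u \<otimes> v) \<otimes> (v' \<otimes> a')" .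
  have "(u' \<otimes> v') \<otimes> (u \<otimes> b) = u \<otimes> (u' \<otimes> (v' \<otimes> b))"
    using c by (metis S_carrier S_lcomm m_assoc m_closed)
  also have "\<dots> = (u \<otimes> v) \<otimes> (u' \<otimes> b')"
    using c 2 by (metis S_carrier S_lcomm m_assoc m_closed)
  finally have B: "(u' \<otimes> v') \<otimes> (u \<otimes> b) = (u \<otimes> v) \<otimes> (u' \<otimes> b')" .
  show "loc_frac R S (u \<otimes> v) (v \<otimes> a \<oplus> u \<otimes> b) = loc_frac R S (u' \<otimes> v') (v' \<otimes> a' \<oplus> u' \<otimes> b')"
    using c A B by (simp add: frac_eq_iff S_mult r_distr)
qed

lemma loc_mult:
  assumes "u \<in> S" "v \<in> S" "a \<in> carrier R" "b \<in> carrier R"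
  shows "loc_frac R S u a \<otimes>\<^bsub>localization R S\<^esub> loc_frac R S v b = loc_frac R S (u \<otimes> v) (a \<otimes> b)"
  using UN_equiv_class2[OF equiv_frac_rel equiv_frac_rel mult_respects, of "(u,a)" "(v,b)"] assms
  by (simp add: localization_def loc_frac_def case_prod_unfold)

lemma loc_add:
  assumes "u \<in> S" "v \<in> S" "a \<in> carrier R" "b \<in> carrier R"
  shows "loc_frac R S u a \<oplus>\<^bsub>localization R S\<^esub> loc_frac R S v b
           = loc_frac R S (u \<otimes> v) (v \<otimes> a \<oplus> u \<otimes> b)"
  using UN_equiv_class2[OF equiv_frac_rel equiv_frac_rel add_respects, of "(u,a)" "(v,b)"] assms
  by (simp add: localization_def loc_frac_def case_prod_unfold)

lemma loc_one:
  assumes "u \<in> S"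
  shows "\<one>\<^bsub>localization R S\<^esub> = loc_frac R S u u"
proof -
  have "loc_frac R S v v = loc_frac R S u u" if "v \<in> S" for v
    using that assms frac_eq_iff[of v u v u] S_comm[of v u] S_carrier by metis
  then have "(\<Union>v \<in> S. loc_frac R S v v) = (\<Union>v \<in> S. loc_frac R S u u)"
    by (rule SUP_cong[OF refl])
  also have "\<dots> = loc_frac R S u u"
    using assms by blast
  finally show ?thesis
    by (simp add: localization_def)
qed

lemma loc_zero:
  assumes "u \<in> S"
  shows "\<zero>\<^bsub>localization R S\<^esub> = loc_frac R S u \<zero>"
proof -
  have "loc_frac R S v \<zero> = loc_frac R S u \<zero>" if "v \<in> S" for v
    using that assms by (simp add: frac_eq_iff)
  then have "(\<Union>v \<in> S. loc_frac R S v \<zero>) = (\<Union>v \<in> S. loc_frac R S u \<zero>)"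
    by (rule SUP_cong[OF refl])
  also have "\<dots> = loc_frac R S u \<zero>"
    using assms by blast
  finally show ?thesis
    by (simp add: localization_def)
qed

lemma frac_expand:
  assumes "u \<in> S" "v \<in> S" "a \<in> carrier R"
  shows "loc_frac R S (v \<otimes> u) (v \<otimes> a) = loc_frac R S u a"
  using assms S_lcomm[of v u a] by (simp add: frac_eq_iff S_mult m_assoc)

lemma common_denominator:
  assumes "X \<in> carrier (localization R S)" "Y \<in> carrier (localization R S)"
  obtains w a b where "w \<in> S" "a \<in> carrier R" "b \<in> carrier R" "X = loc_frac R S w a" "Y = loc_frac R S w b"
proof -
  obtain u a v b where *: "u \<in> S" "a \<in> carrier R" "X = loc_frac R S u a"
      "v \<in> S" "b \<in> carrier R" "Y = loc_frac R S v b"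
    using localization_cases[OF assms(1)] localization_cases[OF assms(2)] by metis
  have "X = loc_frac R S (v \<otimes> u) (v \<otimes> a)" "Y = loc_frac R S (v \<otimes> u) (u \<otimes> b)"
    using * frac_expand[of u v a] frac_expand[of v u b] S_comm[of u v] by auto
  then show ?thesis
    using * that[of "v \<otimes> u" "v \<otimes> a" "u \<otimes> b"] by (simp add: S_mult)
qed

lemma loc_add_same:
  assumes "w \<in> S" "a \<in> carrier R" "b \<in> carrier R"
  shows "loc_frac R S w a \<oplus>\<^bsub>localization R S\<^esub> loc_frac R S w b = loc_frac R S w (a \<oplus> b)"
  using assms frac_expand[of w w "a \<oplus> b"] by (simp add: loc_add r_distr)

lemma common_denominator3:
  assumes "X \<in> carrier (localization R S)" "Y \<in> carrier (localization R S)"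
    "Z \<in> carrier (localization R S)"
  obtains w a b c where "w \<in> S" "a \<in> carrier R" "b \<in> carrier R" "c \<in> carrier R"
    "X = loc_frac R S w a" "Y = loc_frac R S w b" "Z = loc_frac R S w c"
proof -
  obtain u a b where 1: "u \<in> S" "a \<in> carrier R" "b \<in> carrier R"
      "X = loc_frac R S u a" "Y = loc_frac R S u b"
    using common_denominator[OF assms(1,2)] .
  obtain v c where 2: "v \<in> S" "c \<in> carrier R" "Z = loc_frac R S v c"
    using localization_cases[OF assms(3)] .
  have "X = loc_frac R S (v \<otimes> u) (v \<otimes> a)" "Y = loc_frac R S (v \<otimes> u) (v \<otimes> b)"
      "Z = loc_frac R S (v \<otimes> u) (u \<otimes> c)"
    using 1 2 frac_expand[of u v a] frac_expand[of u v b] frac_expand[of v u c] S_comm[of u v]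
    by auto
  then show ?thesis
    using 1 2 that[of "v \<otimes> u" "v \<otimes> a" "v \<otimes> b" "u \<otimes> c"] by (simp add: S_mult)
qed

theorem localization_ring: "ring (localization R S)"
proof -
  obtain s where s: "s \<in> S"
    using S_nonempty by blast
  have ag: "abelian_group (localization R S)"
  proof (rule abelian_groupI)
    fix x y assume "x \<in> carrier (localization R S)" "y \<in> carrier (localization R S)"
    then show "x \<oplus>\<^bsub>localization R S\<^esub> y \<in> carrier (localization R S)"
      by (rule common_denominator) (auto simp: loc_add_same)
  next
    show "\<zero>\<^bsub>localization R S\<^esub> \<in> carrier (localization R S)"
      using s by (simp add: loc_zero[OF s])
  next
    fix x y z assume "x \<in> carrier (localization R S)" "y \<in> carrier (localization R S)"
      "z \<in> carrier (localization R S)"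
    then show "x \<oplus>\<^bsub>localization R S\<^esub> y \<oplus>\<^bsub>localization R S\<^esub> z
        = x \<oplus>\<^bsub>localization R S\<^esub> (y \<oplus>\<^bsub>localization R S\<^esub> z)"
      by (rule common_denominator3) (simp add: loc_add_same a_assoc)
  next
    fix x y assume "x \<in> carrier (localization R S)" "y \<in> carrier (localization R S)"
    then show "x \<oplus>\<^bsub>localization R S\<^esub> y = y \<oplus>\<^bsub>localization R S\<^esub> x"
      by (rule common_denominator) (auto simp: loc_add_same a_comm)
  next
    fix x assume "x \<in> carrier (localization R S)"
    then show "\<zero>\<^bsub>localization R S\<^esub> \<oplus>\<^bsub>localization R S\<^esub> x = x"
      by (rule localization_cases) (auto simp: loc_zero loc_add_same)
  next
    fix x assume "x \<in> carrier (localization R S)"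
    then obtain u a where x: "u \<in> S" "a \<in> carrier R" "x = loc_frac R S u a"
      by (rule localization_cases)
    then have "loc_frac R S u (\<ominus> a) \<oplus>\<^bsub>localization R S\<^esub> x = \<zero>\<^bsub>localization R S\<^esub>"
      by (simp add: loc_zero[of u] loc_add_same l_neg)
    then show "\<exists>y\<in>carrier (localization R S).
        y \<oplus>\<^bsub>localization R S\<^esub> x = \<zero>\<^bsub>localization R S\<^esub>"
      using x by (intro bexI[of _ "loc_frac R S u (\<ominus> a)"]) auto
  qed
  have mon: "monoid (localization R S)"
  proof (rule monoidI)
    fix x y assume "x \<in> carrier (localization R S)" "y \<in> carrier (localization R S)"
    then show "x \<otimes>\<^bsub>localization R S\<^esub> y \<in> carrier (localization R S)"
      by (rule common_denominator) (auto simp: loc_mult S_mult)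
  next
    show "\<one>\<^bsub>localization R S\<^esub> \<in> carrier (localization R S)"
      using s by (simp add: loc_one[OF s])
  next
    fix x y z assume "x \<in> carrier (localization R S)" "y \<in> carrier (localization R S)"
      "z \<in> carrier (localization R S)"
    then show "x \<otimes>\<^bsub>localization R S\<^esub> y \<otimes>\<^bsub>localization R S\<^esub> z
        = x \<otimes>\<^bsub>localization R S\<^esub> (y \<otimes>\<^bsub>localization R S\<^esub> z)"
      by (rule common_denominator3) (simp add: loc_mult S_mult m_assoc)
  next
    fix x assume "x \<in> carrier (localization R S)"
    then obtain u a where x: "u \<in> S" "a \<in> carrier R" "x = loc_frac R S u a"
      by (rule localization_cases)
    show "\<one>\<^bsub>localization R S\<^esub> \<otimes>\<^bsub>localization R S\<^esub> x = x"
      using x frac_expand[of u u a] by (simp add: loc_one[of u] loc_mult)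
    show "x \<otimes>\<^bsub>localization R S\<^esub> \<one>\<^bsub>localization R S\<^esub> = x"
      using x frac_expand[of u u a] S_comm[of u a] by (simp add: loc_one[of u] loc_mult)
  qed
  show ?thesis
  proof (rule ringI[OF ag mon])
    fix x y z assume "x \<in> carrier (localization R S)" "y \<in> carrier (localization R S)"
      "z \<in> carrier (localization R S)"
    then obtain w a b c where *: "w \<in> S" "a \<in> carrier R" "b \<in> carrier R" "c \<in> carrier R"
      "x = loc_frac R S w a" "y = loc_frac R S w b" "z = loc_frac R S w c"
      by (rule common_denominator3)
    show "(x \<oplus>\<^bsub>localization R S\<^esub> y) \<otimes>\<^bsub>localization R S\<^esub> z
        = x \<otimes>\<^bsub>localization R S\<^esub> z \<oplus>\<^bsub>localization R S\<^esub> y \<otimes>\<^bsub>localization R S\<^esub> z"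
      using * by (simp add: loc_add_same loc_mult S_mult l_distr)
    show "z \<otimes>\<^bsub>localization R S\<^esub> (x \<oplus>\<^bsub>localization R S\<^esub> y)
        = z \<otimes>\<^bsub>localization R S\<^esub> x \<oplus>\<^bsub>localization R S\<^esub> z \<otimes>\<^bsub>localization R S\<^esub> y"
      using * by (simp add: loc_add_same loc_mult S_mult r_distr)
  qed
qed

end

end

(* The prime radical of any ring consists of its strongly nilpotent elements: those from which
   every sequence of the form a(n+1) = a(n) r(n) a(n) reaches 0.  Passing from a to a fraction
   u^{-1} a only changes the denominators along such a sequence, so u^{-1} a lies in the prime
   radical of the localization if and only if a lies in the prime radical of R.  Since u^{-1} a = 0
   only for a = 0, the condition "xyz = 0 implies yxz in the radical" transfers both ways. *)
theory Submission
  imports Defs "HOL-Algebra.Ring_Divisibility"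
begin

(* Well-founded form: no sequence a(n+1) = a(n) r(n) a(n) avoids 0 forever. *)
inductive strongly_nilpotent :: "('a, 'm) ring_scheme \<Rightarrow> 'a \<Rightarrow> bool"
  for R (structure) where
  zero: "strongly_nilpotent R \<zero>"
| step: "\<lbrakk>a \<in> carrier R; \<And>r. r \<in> carrier R \<Longrightarrow> strongly_nilpotent R (a \<otimes> r \<otimes> a)\<rbrakk>
    \<Longrightarrow> strongly_nilpotent R a"

section \<open>Strong nilpotence and prime ideals in an arbitrary ring\<close>

context ring
begin

text \<open>The factor \<open>r\<close> between \<open>x\<close> and \<open>b\<close> makes this set
  closed under right multiplication: replacing \<open>x\<close> by \<open>x \<otimes> s\<close> only
  replaces \<open>r\<close> by \<open>s \<otimes> r\<close>.\<close>

lemma left_annihilator_mod_ideal: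
  assumes P: "ideal P R" and b: "b \<in> carrier R"
  shows "ideal {x \<in> carrier R. \<forall>r \<in> carrier R. x \<otimes> r \<otimes> b \<in> P} R"
proof -
  interpret P: ideal P R by (rule P)
  show ?thesis
  proof (rule idealI[OF ring_axioms])
    show "subgroup {x \<in> carrier R. \<forall>r \<in> carrier R. x \<otimes> r \<otimes> b \<in> P} (add_monoid R)"
      \<comment> \<open>Folding \<open>a_inv_def\<close> turns inverses in the additive monoid into
        ring negation, so that \<open>l_minus\<close> applies.\<close>
      unfolding subgroup_def a_inv_def[symmetric] using b by (auto simp: l_distr l_minus)
  next
    fix x s assume "x \<in> {x \<in> carrier R. \<forall>r \<in> carrier R. x \<otimes> r \<otimes> b \<in> P}" "s \<in> carrier R"
    then show "s \<otimes> x \<in> {x \<in> carrier R. \<forall>r \<in> carrier R. x \<otimes> r \<otimes> b \<in> P}"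
      using b P.I_l_closed by (auto simp: m_assoc)
  next
    fix x s assume "x \<in> {x \<in> carrier R. \<forall>r \<in> carrier R. x \<otimes> r \<otimes> b \<in> P}" "s \<in> carrier R"
    then show "x \<otimes> s \<in> {x \<in> carrier R. \<forall>r \<in> carrier R. x \<otimes> r \<otimes> b \<in> P}"
      using b by (simp add: m_assoc[of x s])
  qed
qed

text \<open>Closure under left multiplication comes from \<open>I\<close> absorbing on the right:
  x(sy) = (xs)y with xs in \<open>I\<close>.\<close>

lemma right_annihilator_mod_ideal:
  assumes P: "ideal P R" and I: "ideal I R"
  shows "ideal {y \<in> carrier R. \<forall>x \<in> I. x \<otimes> y \<in> P} R"
proof -
  interpret P: ideal P R by (rule P)
  interpret I: ideal I R by (rule I)
  show ?thesis
  proof (rule idealI[OF ring_axioms])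
    show "subgroup {y \<in> carrier R. \<forall>x \<in> I. x \<otimes> y \<in> P} (add_monoid R)"
      unfolding subgroup_def a_inv_def[symmetric] by (auto simp: r_distr r_minus I.Icarr)
  next
    fix y s assume "y \<in> {y \<in> carrier R. \<forall>x \<in> I. x \<otimes> y \<in> P}" "s \<in> carrier R"
    then show "s \<otimes> y \<in> {y \<in> carrier R. \<forall>x \<in> I. x \<otimes> y \<in> P}"
      using I.I_r_closed by (auto simp: m_assoc[symmetric] I.Icarr)
  next
    fix y s assume "y \<in> {y \<in> carrier R. \<forall>x \<in> I. x \<otimes> y \<in> P}" "s \<in> carrier R"
    then show "y \<otimes> s \<in> {y \<in> carrier R. \<forall>x \<in> I. x \<otimes> y \<in> P}"
      using P.I_r_closed by (auto simp: m_assoc[symmetric] I.Icarr)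
  qed
qed

text \<open>Primeness speaks of ideals, so \<open>a\<close> has to be placed in two ideals with
  product inside \<open>P\<close>. Taking two annihilators modulo \<open>P\<close> achieves this
  without describing the ideal generated by \<open>a\<close>: the product condition is built into
  \<open>J\<close>, and \<open>a\<close> lies in both.\<close>

lemma nc_primeideal_semiprime:
  assumes P: "nc_primeideal P R" and a: "a \<in> carrier R"
    and aRa: "\<And>r. r \<in> carrier R \<Longrightarrow> a \<otimes> r \<otimes> a \<in> P"
  shows "a \<in> P"
proof -
  have idP: "ideal P R"
    using P by (simp add: nc_primeideal_def)
  define I where "I = {x \<in> carrier R. \<forall>r \<in> carrier R. x \<otimes> r \<otimes> a \<in> P}"
  define J where "J = {y \<in> carrier R. \<forall>x \<in> I. x \<otimes> y \<in> P}"
  have I: "ideal I R"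
    unfolding I_def using idP a by (rule left_annihilator_mod_ideal)
  have J: "ideal J R"
    unfolding J_def using idP I by (rule right_annihilator_mod_ideal)
  have "ideal_prod R I J \<subseteq> P"
  proof
    fix x assume "x \<in> ideal_prod R I J"
    then show "x \<in> P"
    proof induction
      case (prod i j)
      then show ?case by (simp add: J_def)
    next
      case (sum x y)
      then show ?case
        by (meson additive_subgroup.a_closed ideal.axioms(1) idP)
    qed
  qed
  then have "I \<subseteq> P \<or> J \<subseteq> P"
    using P I J unfolding nc_primeideal_def by blast
  moreover have "a \<in> I"
    using a aRa by (simp add: I_def)
  moreover have "a \<in> J"
  proof -
    have "x \<otimes> a \<in> P" if "x \<in> I" for x
    proof -
      \<comment> \<open>The case r = 1 of the condition defining \<open>I\<close>.\<close>
      have "x \<in> carrier R" "x \<otimes> \<one> \<otimes> a \<in> P"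
        using that unfolding I_def by blast+
      then show ?thesis by simp
    qed
    then show ?thesis
      using a by (simp add: J_def)
  qed
  ultimately show ?thesis by blast
qed

(* An ideal maximal among those avoiding the sequence is prime: if two ideals are strictly larger,
   both contain a common term f n, and f (n + 1) = f n r f n lies in their product. *)
lemma nc_primeideal_avoiding_sequence:
  assumes f: "\<And>n. f n \<in> carrier R" "\<And>n. f n \<noteq> \<zero>"
    and step: "\<And>n. \<exists>r \<in> carrier R. f (Suc n) = f n \<otimes> r \<otimes> f n"
  shows "\<exists>P. nc_primeideal P R \<and> (\<forall>n. f n \<notin> P)"
proof -
  \<comment> \<open>An ideal that contains one term contains all later ones; this lets two ideals be
    compared at the index \<open>max k l\<close>.\<close>
  have up: "f n \<in> I" if "ideal I R" "f m \<in> I" "m \<le> n" for I m n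
    using that(3)
  proof (induction rule: dec_induct)
    case base
    show ?case by (rule that(2))
  next
    case (step n)
    obtain r where "r \<in> carrier R" "f (Suc n) = f n \<otimes> r \<otimes> f n"
      using assms(3) by blast
    then show ?case
      using step.IH f ideal.I_r_closed[OF that(1)] by (simp add: m_assoc)
  qed
  define \<A> where "\<A> = {I. ideal I R \<and> (\<forall>n. f n \<notin> I)}"
  have "\<exists>P \<in> \<A>. \<forall>X \<in> \<A>. P \<subseteq> X \<longrightarrow> X = P"
  proof (rule subset_Zorn_nonempty)
    show "\<A> \<noteq> {}"
      using zeroideal f by (auto simp: \<A>_def)
  next
    fix \<C> assume C: "\<C> \<noteq> {}" "subset.chain \<A> \<C>"
    then have "subset.chain {I. ideal I R} \<C>"
      by (auto simp: pred_on.chain_def \<A>_def)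
    from chain_Union_is_ideal[OF this] show "\<Union>\<C> \<in> \<A>"
      using C by (auto simp: \<A>_def pred_on.chain_def)
  qed
  then obtain P where PA: "P \<in> \<A>" and maximal: "\<forall>X \<in> \<A>. P \<subseteq> X \<longrightarrow> X = P"
    by (elim bexE)
  have P: "ideal P R" "\<And>n. f n \<notin> P"
    using PA by (simp_all add: \<A>_def)
  interpret P: ideal P R by (rule P(1))
  \<comment> \<open>Otherwise P + I would be a member of \<open>\<A>\<close> above \<open>P\<close>,
    hence equal to \<open>P\<close> by maximality, forcing \<open>I\<close> into
    \<open>P\<close>.\<close>
  have meets: "\<exists>m. f m \<in> P <+> I" if I: "ideal I R" "\<not> I \<subseteq> P" for I
  proof (rule ccontr)
    assume no: "\<nexists>m. f m \<in> P <+> I"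
    have eq: "Idl (P \<union> I) = P <+> I"
      by (rule union_genideal[OF P(1) I(1)])
    have "P \<union> I \<subseteq> carrier R"
      using P.Icarr ideal.Icarr[OF I(1)] by blast
    then have sub: "P \<union> I \<subseteq> P <+> I"
      using genideal_self[of "P \<union> I"] eq by simp
    then have "P <+> I = P"
      using maximal add_ideals[OF P(1) I(1)] no by (simp add: \<A>_def)
    then show False
      using sub I(2) by blast
  qed
  have "I \<subseteq> P \<or> J \<subseteq> P" if I: "ideal I R" and J: "ideal J R" and IJ: "ideal_prod R I J \<subseteq> P" for I J
  proof (rule ccontr)
    assume "\<not> (I \<subseteq> P \<or> J \<subseteq> P)"
    then obtain k l where "f k \<in> P <+> I" "f l \<in> P <+> J"
      using meets I J by blast
    then have "f (max k l) \<in> P <+> I" "f (max k l) \<in> P <+> J"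
      using up[OF add_ideals[OF P(1) I], of k "max k l"] up[OF add_ideals[OF P(1) J], of l "max k l"] by auto
    then obtain n p i q j where n: "f n = p \<oplus> i" "f n = q \<oplus> j"
      and mem: "p \<in> P" "i \<in> I" "q \<in> P" "j \<in> J"
      unfolding set_add_def' by blast
    obtain r where r: "r \<in> carrier R" "f (Suc n) = f n \<otimes> r \<otimes> f n"
      using step by blast
    have carr: "p \<in> carrier R" "i \<in> carrier R" "q \<in> carrier R" "j \<in> carrier R"
      using mem P.Icarr ideal.Icarr[OF I] ideal.Icarr[OF J] by auto
    \<comment> \<open>The left factor \<open>f n\<close> is decomposed in P + I and the right one in
      P + J. After expansion every summand has a factor \<open>p\<close> or \<open>q\<close> from
      \<open>P\<close>, except i r j, which lies in the product of \<open>I\<close> and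
      \<open>J\<close>.\<close>
    have "f (Suc n) = (p \<oplus> i) \<otimes> r \<otimes> (q \<oplus> j)"
      using r(2) by (subst (asm) (1) n(1), subst (asm) n(2))
    also have "\<dots> = p \<otimes> (r \<otimes> (q \<oplus> j)) \<oplus> (i \<otimes> r \<otimes> q \<oplus> (i \<otimes> r) \<otimes> j)"
      using carr r(1) by (simp add: l_distr r_distr m_assoc a_ac)
    also have "\<dots> \<in> P"
    proof -
      have "i \<otimes> r \<in> I"
        using ideal.I_r_closed[OF I] mem r(1) by blast
      then have "(i \<otimes> r) \<otimes> j \<in> P"
        using ideal_prod.prod[of "i \<otimes> r" I j J R] IJ mem(4) by auto
      then show ?thesis
        using carr r(1) mem by (simp add: P.I_l_closed P.I_r_closed)
    qed
    finally show False
      using P(2) by blast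
  qed
  moreover have "P \<noteq> carrier R"
    using P(2) f(1) by blast
  ultimately show ?thesis
    using P unfolding nc_primeideal_def by blast
qed

theorem prime_radical_iff_strongly_nilpotent:
  "a \<in> prime_radical R \<longleftrightarrow> strongly_nilpotent R a"
proof
  assume "strongly_nilpotent R a"
  then show "a \<in> prime_radical R"
  proof induction
    case zero
    then show ?case
      by (simp add: prime_radical_def nc_primeideal_def additive_subgroup.zero_closed[OF ideal.axioms(1)])
  next
    case (step a)
    then show ?case
      using nc_primeideal_semiprime[of _ a] by (auto simp: prime_radical_def)
  qed
next
  assume a: "a \<in> prime_radical R"
  show "strongly_nilpotent R a"
  proof (rule ccontr)
    assume na: "\<not> strongly_nilpotent R a"
    \<comment> \<open>Failure of strong nilpotence is the invariant: by the rule \<open>step\<close>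
      it passes to some a(n) r a(n), and by the rule \<open>zero\<close> it keeps every term
      nonzero. The clause for n = 0 pins the start at \<open>a\<close>.\<close>
    have "\<exists>f. \<forall>n. (f n \<in> carrier R \<and> \<not> strongly_nilpotent R (f n) \<and> (n = 0 \<longrightarrow> f n = a)) \<and>
        (\<exists>r \<in> carrier R. f (Suc n) = f n \<otimes> r \<otimes> f n)"
    proof (rule dependent_nat_choice)
      show "\<exists>x. x \<in> carrier R \<and> \<not> strongly_nilpotent R x \<and> ((0::nat) = 0 \<longrightarrow> x = a)"
        using a na by (auto simp: prime_radical_def)
    next
      fix x and n :: nat
      assume x: "x \<in> carrier R \<and> \<not> strongly_nilpotent R x \<and> (n = 0 \<longrightarrow> x = a)"
      then obtain r where "r \<in> carrier R" "\<not> strongly_nilpotent R (x \<otimes> r \<otimes> x)"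
        using strongly_nilpotent.step[of x R] by auto
      then show "\<exists>y. (y \<in> carrier R \<and> \<not> strongly_nilpotent R y \<and> (Suc n = 0 \<longrightarrow> y = a)) \<and>
          (\<exists>r \<in> carrier R. y = x \<otimes> r \<otimes> x)"
        using x by (intro exI[of _ "x \<otimes> r \<otimes> x"]) auto
    qed
    then obtain f where "\<forall>n. (f n \<in> carrier R \<and> \<not> strongly_nilpotent R (f n) \<and> (n = 0 \<longrightarrow> f n = a)) \<and>
        (\<exists>r \<in> carrier R. f (Suc n) = f n \<otimes> r \<otimes> f n)"
      by (elim exE)
    then have f: "\<And>n. f n \<in> carrier R" "\<And>n. \<not> strongly_nilpotent R (f n)" "f 0 = a"
      "\<And>n. \<exists>r \<in> carrier R. f (Suc n) = f n \<otimes> r \<otimes> f n"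
      by simp_all
    have "f n \<noteq> \<zero>" for n
      using f(2)[of n] strongly_nilpotent.zero[of R] by auto
    then show False
      using nc_primeideal_avoiding_sequence[of f] f(1,4) f(3)[symmetric] a
      by (auto simp: prime_radical_def)
  qed
qed

end

section \<open>Transfer between the ring and its localization\<close>

context central_regular_mult_set
begin

lemma loc_frac_eq_zero_iff:
  assumes "u \<in> S" "a \<in> carrier R"
  shows "loc_frac R S u a = \<zero>\<^bsub>localization R S\<^esub> \<longleftrightarrow> a = \<zero>"
  using assms S_cancel[of u a \<zero>] by (auto simp: loc_zero[of u] frac_eq_iff)

text \<open>The denominator must stay arbitrary in the induction: a middle factor with denominator
  \<open>v\<close> turns \<open>u\<close> into u v u.\<close>

lemma strongly_nilpotent_loc_fracI:
  assumes "strongly_nilpotent R a" "u \<in> S"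
  shows "strongly_nilpotent (localization R S) (loc_frac R S u a)"
  using assms
proof (induction arbitrary: u)
  case zero
  then show ?case
    using strongly_nilpotent.zero[of "localization R S"] by (simp add: loc_zero)
next
  case (step a)
  show ?case
  proof (rule strongly_nilpotent.step)
    show "loc_frac R S u a \<in> carrier (localization R S)"
      using step by simp
  next
    fix x assume "x \<in> carrier (localization R S)"
    then obtain v r where "v \<in> S" "r \<in> carrier R" "x = loc_frac R S v r"
      by (rule localization_cases)
    then show "strongly_nilpotent (localization R S)
        (loc_frac R S u a \<otimes>\<^bsub>localization R S\<^esub> x \<otimes>\<^bsub>localization R S\<^esub> loc_frac R S u a)"
      using step by (simp add: loc_mult S_mult)
  qed
qed

lemma strongly_nilpotent_loc_fracD:
  assumes "strongly_nilpotent (localization R S) (loc_frac R S u a)" "u \<in> S" "a \<in> carrier R"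
  shows "strongly_nilpotent R a"
  using assms
proof (induction "loc_frac R S u a" arbitrary: u a)
  case zero
  then show ?case
    using loc_frac_eq_zero_iff[of u a] strongly_nilpotent.zero[of R] by simp
next
  case (step u a)
  show ?case
  proof (rule strongly_nilpotent.step)
    show "a \<in> carrier R" by fact
  next
    fix r assume r: "r \<in> carrier R"
    \<comment> \<open>The element \<open>r\<close> is represented in the localization by the
      fraction with denominator \<open>u\<close>, an element of \<open>S\<close> already at hand.
      The induction hypothesis then applies with denominator u u u.\<close>
    show "strongly_nilpotent R (a \<otimes> r \<otimes> a)"
    proof (rule step.hyps(3)[of "loc_frac R S u r" "u \<otimes> u \<otimes> u"])
      show "loc_frac R S u a \<otimes>\<^bsub>localization R S\<^esub> loc_frac R S u r \<otimes>\<^bsub>localization R S\<^esub> loc_frac R S u a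
          = loc_frac R S (u \<otimes> u \<otimes> u) (a \<otimes> r \<otimes> a)"
        using r step.prems by (simp add: loc_mult S_mult)
    qed (use r step.prems in \<open>simp_all add: S_mult\<close>)
  qed
qed

lemma loc_frac_in_prime_radical_iff:
  assumes "u \<in> S" "a \<in> carrier R"
  shows "loc_frac R S u a \<in> prime_radical (localization R S) \<longleftrightarrow> a \<in> prime_radical R"
  using assms strongly_nilpotent_loc_fracI strongly_nilpotent_loc_fracD
  by (auto simp: prime_radical_iff_strongly_nilpotent
      ring.prime_radical_iff_strongly_nilpotent[OF localization_ring])

theorem P_symmetric_localization_iff: "P_symmetric R \<longleftrightarrow> P_symmetric (localization R S)"
proof
  assume sym: "P_symmetric R"
  show "P_symmetric (localization R S)"
    unfolding P_symmetric_def
  proof (intro ballI impI)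
    fix x y z
    assume "x \<in> carrier (localization R S)" "y \<in> carrier (localization R S)"
      "z \<in> carrier (localization R S)"
      and 0: "x \<otimes>\<^bsub>localization R S\<^esub> y \<otimes>\<^bsub>localization R S\<^esub> z = \<zero>\<^bsub>localization R S\<^esub>"
    then obtain w a b c where *: "w \<in> S" "a \<in> carrier R" "b \<in> carrier R" "c \<in> carrier R"
      "x = loc_frac R S w a" "y = loc_frac R S w b" "z = loc_frac R S w c"
      by (blast elim: common_denominator3)
    \<comment> \<open>The product of the three fractions has numerator abc, and a fraction vanishes
      only if its numerator does.\<close>
    then have "a \<otimes> b \<otimes> c = \<zero>"
      using 0 by (simp add: loc_mult S_mult loc_frac_eq_zero_iff)
    then have "b \<otimes> a \<otimes> c \<in> prime_radical R"
      using sym * by (simp add: P_symmetric_def)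
    then show "y \<otimes>\<^bsub>localization R S\<^esub> x \<otimes>\<^bsub>localization R S\<^esub> z \<in> prime_radical (localization R S)"
      using * by (simp add: loc_mult S_mult loc_frac_in_prime_radical_iff)
  qed
next
  assume sym: "P_symmetric (localization R S)"
  obtain u where u: "u \<in> S"
    using S_nonempty by blast
  show "P_symmetric R"
    unfolding P_symmetric_def
  proof (intro ballI impI)
    fix a b c
    assume *: "a \<in> carrier R" "b \<in> carrier R" "c \<in> carrier R" and 0: "a \<otimes> b \<otimes> c = \<zero>"
    \<comment> \<open>This map is not claimed to be multiplicative: a threefold product has
      denominator u u u. Vanishing and membership in the prime radical depend on the numerator
      alone, so it serves in place of an embedding.\<close>
    let ?q = "loc_frac R S u"
    have "?q a \<otimes>\<^bsub>localization R S\<^esub> ?q b \<otimes>\<^bsub>localization R S\<^esub> ?q c = \<zero>\<^bsub>localization R S\<^esub>"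
      using * 0 u by (simp add: loc_mult S_mult loc_frac_eq_zero_iff)
    then have "?q b \<otimes>\<^bsub>localization R S\<^esub> ?q a \<otimes>\<^bsub>localization R S\<^esub> ?q c \<in> prime_radical (localization R S)"
      using sym * u by (simp add: P_symmetric_def)
    then show "b \<otimes> a \<otimes> c \<in> prime_radical R"
      using * u by (simp add: loc_mult S_mult loc_frac_in_prime_radical_iff)
  qed
qed

end

theorem theorem2p17:
  fixes R :: "('a, 'm) ring_scheme" (structure) and S :: "'a set"
  assumes "ring R"
    and "S \<noteq> {}"
    and "\<And>u v. \<lbrakk>u \<in> S; v \<in> S\<rbrakk> \<Longrightarrow> u \<otimes> v \<in> S"
    and "\<And>u. u \<in> S \<Longrightarrow> central_element R u"
    and "\<And>u. u \<in> S \<Longrightarrow> regular_element R u"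
  shows "P_symmetric R \<longleftrightarrow> P_symmetric (localization R S)"
proof -
  interpret central_regular_mult_set R S
    using assms by (simp add: central_regular_mult_set_def central_regular_mult_set_axioms_def)
  show ?thesis
    by (rule P_symmetric_localization_iff)
qed

end
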